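(* Let $\Sigma$ be a finite alphabet and $\mathbb{D}$ a value domain. A property $\varPhi : \Sigma^\omega \to \mathbb{D}$ is safe if and only if it is an $\mathsf{Inf}$-property.
   Context: $\Sigma^*$ and $\Sigma^\omega$ are the sets of finite and infinite words over the finite nonempty alphabet $\Sigma$; $u \prec w$ means that the finite word $u$ is a strict prefix of $w$ (the empty word is allowed). A value domain $\mathbb{D}$ is a complete lattice with $\bot \neq \top$. A property is a total function $\varPhi : \Sigma^\omega \to \mathbb{D}$. $\varPhi$ is safe when for every $w \in \Sigma^\omega$ and $v \in \mathbb{D}$ with $\varPhi(w) \not\geq v$, there is $u \prec w$ such that $\sup_{w' \in \Sigma^\omega} \varPhi(uw') \not\geq v$. $\varPhi$ is an $\mathsf{Inf}$-property when there is a function $\pi : \Sigma^* \to \mathbb{D}$ (a finitary property) such that $\varPhi(w) = \inf_{u \prec w} \pi(u)$ for all $w \in \Sigma^\omega$. *)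

theory Defs
  imports Main "HOL-Library.Stream"
begin

text \<open>
  The alphabet is a type of class \<open>finite\<close> (hence nonempty); finite and infinite words over it are
  \<open>'a list\<close> and \<open>'a stream\<close>, with \<open>u @- w\<close> the concatenation. A value domain is a type of class
  \<open>complete_lattice\<close> together with \<open>bot \<noteq> top\<close>, which the class alone does not imply. Its order need not
  be total, so \<open>\<not> v \<le> x\<close> is not the same as \<open>x < v\<close>.
\<close>

type_synonym ('a, 'd) property = "'a stream \<Rightarrow> 'd"

type_synonym ('a, 'd) finitary_property = "'a list \<Rightarrow> 'd"

text \<open>Every finite prefix of an infinite word, the empty word included, is a strict one.\<close>

definition strict_prefix_of :: "'a list \<Rightarrow> 'a stream \<Rightarrow> bool" (infix \<open>\<prec>\<close> 50) where
  "u \<prec> w \<longleftrightarrow> (\<exists>w'. w = u @- w')"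

definition safe :: "('a, 'd::complete_lattice) property \<Rightarrow> bool" where
  "safe \<Phi> \<longleftrightarrow>
     (\<forall>w v. \<not> \<Phi> w \<ge> v \<longrightarrow> (\<exists>u. u \<prec> w \<and> \<not> (SUP w'. \<Phi> (u @- w')) \<ge> v))"

definition Inf_property :: "('a, 'd::complete_lattice) property \<Rightarrow> bool" where
  "Inf_property \<Phi> \<longleftrightarrow>
     (\<exists>\<pi> :: ('a, 'd) finitary_property. \<forall>w. \<Phi> w = (INF u\<in>{u. u \<prec> w}. \<pi> u))"

end

theory Submission
  imports Defs
begin

text \<open>The canonical finitary witness sends \<open>u\<close> to the supremum of
  \<open>\<Phi>\<close> over all continuations of \<open>u\<close>. Its infimum along
  \<open>w\<close> is always at least \<open>\<Phi> w\<close>, and safety is what forbids a gap.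
  Conversely, any \<open>\<pi>\<close> whose infima give \<open>\<Phi>\<close> bounds that supremum
  from above at each \<open>u\<close>, so a prefix at which \<open>\<pi>\<close> refutes a value
  \<open>v\<close> also witnesses safety.\<close>

theorem theorem4p5:
  fixes \<Phi> :: "('a::finite, 'd::complete_lattice) property"
  assumes "(bot :: 'd) \<noteq> top"
  shows "safe \<Phi> \<longleftrightarrow> Inf_property \<Phi>"
proof
  assume safe: "safe \<Phi>"
  define \<pi> where "\<pi> u = (SUP w'. \<Phi> (u @- w'))" for u
  have "\<Phi> w = (INF u\<in>{u. u \<prec> w}. \<pi> u)" for w
  proof (rule antisym)
    show "\<Phi> w \<le> (INF u\<in>{u. u \<prec> w}. \<pi> u)"
      unfolding \<pi>_def by (auto simp: strict_prefix_of_def intro!: INF_greatest SUP_upper)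
    show "(INF u\<in>{u. u \<prec> w}. \<pi> u) \<le> \<Phi> w"
    proof (rule ccontr)
      assume "\<not> (INF u\<in>{u. u \<prec> w}. \<pi> u) \<le> \<Phi> w"
      \<comment> \<open>Safety is applied with the infimum itself as the value \<open>v\<close>; the
        resulting prefix contradicts that it is a lower bound.\<close>
      then obtain u where "u \<prec> w" and "\<not> (INF u\<in>{u. u \<prec> w}. \<pi> u) \<le> \<pi> u"
        using safe unfolding safe_def \<pi>_def by blast
      then show False by (simp add: INF_lower)
    qed
  qed
  then show "Inf_property \<Phi>" unfolding Inf_property_def by blast
next
  assume "Inf_property \<Phi>"
  then obtain \<pi> where \<pi>: "\<And>w. \<Phi> w = (INF u\<in>{u. u \<prec> w}. \<pi> u)"
    unfolding Inf_property_def by blast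
  show "safe \<Phi>"
    unfolding safe_def
  proof (intro allI impI)
    fix w v
    assume "\<not> \<Phi> w \<ge> v"
    \<comment> \<open>Being below an infimum means being below every member, so a single prefix
      refutes \<open>v\<close>, even in a partial order.\<close>
    then obtain u where u: "u \<prec> w" "\<not> v \<le> \<pi> u"
      unfolding \<pi> le_INF_iff by blast
    have "\<Phi> (u @- w') \<le> \<pi> u" for w'
      unfolding \<pi> by (rule INF_lower) (auto simp: strict_prefix_of_def)
    then have "(SUP w'. \<Phi> (u @- w')) \<le> \<pi> u" by (rule SUP_least)
    with u show "\<exists>u. u \<prec> w \<and> \<not> (SUP w'. \<Phi> (u @- w')) \<ge> v"
      using order_trans by blast
  qed
qed

end
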